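(* Consider a VRPSD instance with recourse costs $\mathcal{Q}_p$, and fix any admissible S-cut data $\mathcal{S}$, $(m_S)_{S\in\mathcal{S}}$, $(\mathcal{L}_S)_{S\in\mathcal{S}}$ (all as defined in the context). The DL-shaped model MP is a valid reformulation of the VRPSD for every set of admissible route counts $M \subseteq \{1,\dots,n\}$ if and only if the superadditivity property holds, i.e., if and only if $\mathcal{Q}_{(p_1,p_2)}\geq\mathcal{Q}_{p_1}+\mathcal{Q}_{p_2}$ for all $p_1,p_2\in\mathcal{P}$ whose concatenation satisfies $(p_1,p_2)\in\mathcal{P}$.
   Context: **Instance.** Let $N=\{1,\dots,n\}$ be customers, $0$ the depot, $N_0=\{0\}\cup N$, $E$ the edge set of the complete undirected graph on $N_0$, with costs $c_e\ge 0$ satisfying the triangle inequality. For $S\subseteq N$, $E(S)$ is the set of edges with both endpoints in $S$. Customers have independent non-negative random demands with finite means $\mu_i$; vehicles have capacity $Q>0$; $f>0$ is the load factor, and $\max_i\mu_i\le fQ$. **Paths.** A path is a nonempty finite sequence $p=(i_1,\dots,i_t)$ of distinct customers, $N(p)=\{i_1,\dots,i_t\}$. The set of feasible paths is $\mathcal{P}=\{p:\sum_{i\in N(p)}\mu_i\le fQ\}$. For paths with disjoint customer sets, $(p_1,p_2)$ denotes their concatenation. **Recourse.** A route-based recourse policy assigns to each path $p$ a finite expected recourse cost $\bar{\mathcal{Q}}_p\ge 0$ of the route $(0,p,0)$. Put $\mathcal{Q}_p=\min\{\bar{\mathcal{Q}}_{(i_1,\dots,i_t)},\bar{\mathcal{Q}}_{(i_t,\dots,i_1)}\}$.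 **First-stage solutions.** For $M\subseteq\{1,\dots,n\}$, a feasible first-stage solution is a vector $x\in\mathbb{Z}_{\ge0}^E$ of edge multiplicities of a collection of $m$ routes $(0,p_1,0),\dots,(0,p_m,0)$, $m\in M$, with $p_k\in\mathcal{P}$ and $\{N(p_k)\}_k$ a partition of $N$ (so $x_e\in\{0,1\}$ for $e\in E(N)$, and $x_{\{0,i\}}=2$ if $(i)$ is one of the paths). Write $\mathcal{P}(x)=\{p_1,\dots,p_m\}$ (orientations arbitrary) and $\mathcal{Q}(x)=\sum_{p\in\mathcal{P}(x)}\mathcal{Q}_p$. The VRPSD is to minimize $\sum_e c_ex_e+\mathcal{Q}(x)$ over feasible $x$. **DL-shaped model.** For a path $p=(i_1,\dots,i_t)$ let $p(x)=\sum_{j=1}^{t-1}x_{\{i_j,i_{j+1}\}}$. For nonempty $S\subseteq N$, let $\Pi(S,m)$ be the set of all sets of $m$ feasible paths whose customer sets partition $S$; $m(S)=\min\{m:\Pi(S,m)\ne\emptyset\}$; $\mathcal{L}(S,m)=\min_{\pi\in\Pi(S,m)}\sum_{p\in\pi}\mathcal{Q}_p$ ($=+\infty$ if $\Pi(S,m)=\emptyset$). Admissible S-cut data consist of any collection $\mathcal{S}$ of nonempty subsets of $N$ and, for each $S\in\mathcal{S}$, an integer $1\le m_S\le m(S)$ and a real $0\le\mathcal{L}_S\le\mathcal{L}(S,m_S)$. The model MP is: minimize $\sum_{e}c_ex_e+\sum_{i\in N}\theta_i$ over feasible first-stage $x$ and $\theta\in\mathbb{R}^N$ subject to - (P-cuts)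 $\sum_{i\in N(p)}\theta_i\ge\mathcal{Q}_p\,(p(x)-|N(p)|+2)$ for all $p\in\mathcal{P}$; - (S-cuts) $\sum_{i\in S}\theta_i\ge\mathcal{L}_S\left(\sum_{e\in E(S)}x_e-|S|+m_S+1\right)$ for all $S\in\mathcal{S}$; - $\theta_i\ge0$ for all $i\in N$. MP is a **valid reformulation** of the VRPSD (for a given $M$) if, for every feasible first-stage solution $x$, the minimum of $\sum_{i\in N}\theta_i$ over all $\theta$ such that $(x,\theta)$ is feasible for MP equals $\mathcal{Q}(x)$. *)

theory Defs
  imports "HOL-Probability.Probability"
begin

section \<open>Instances\<close>

text \<open>Vertex 0 is the depot, the customers are \<open>1, \<dots>, n\<close>, and an undirected edge is the
  two-element set of its endpoints.\<close>

record 'w vrpsd =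
  num_customers :: nat
  edge_cost :: "nat set \<Rightarrow> real"
  scenarios :: "'w measure"
  demand :: "nat \<Rightarrow> 'w \<Rightarrow> real"
  capacity :: real
  load_factor :: real
  route_recourse :: "nat list \<Rightarrow> real"

definition customers :: "'w vrpsd \<Rightarrow> nat set" where
  "customers I = {1..num_customers I}"

definition edges :: "nat set \<Rightarrow> nat set set" where
  "edges S = {{i, j} | i j. i \<in> S \<and> j \<in> S \<and> i \<noteq> j}"

definition mean_demand :: "'w vrpsd \<Rightarrow> nat \<Rightarrow> real" where
  "mean_demand I i = integral\<^sup>L (scenarios I) (demand I i)"

definition paths :: "'w vrpsd \<Rightarrow> nat list set" where
  "paths I = {p. p \<noteq> [] \<and> distinct p \<and> set p \<subseteq> customers I}"

definition vrpsd_instance :: "'w vrpsd \<Rightarrow> bool" where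
  "vrpsd_instance I \<longleftrightarrow>
     (\<forall>e\<in>edges (insert 0 (customers I)). 0 \<le> edge_cost I e) \<and>
     (\<forall>i\<in>insert 0 (customers I). \<forall>j\<in>insert 0 (customers I). \<forall>k\<in>insert 0 (customers I).
        i \<noteq> j \<longrightarrow> j \<noteq> k \<longrightarrow> i \<noteq> k \<longrightarrow>
        edge_cost I {i, k} \<le> edge_cost I {i, j} + edge_cost I {j, k}) \<and>
     prob_space (scenarios I) \<and>
     prob_space.indep_vars (scenarios I) (\<lambda>_. borel) (demand I) (customers I) \<and>
     (\<forall>i\<in>customers I. (AE w in scenarios I. 0 \<le> demand I i w) \<and>
        integrable (scenarios I) (demand I i)) \<and>
     0 < capacity I \<and> 0 < load_factor I \<and>
     (\<forall>i\<in>customers I. mean_demand I i \<le> load_factor I * capacity I) \<and>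
     (\<forall>p\<in>paths I. 0 \<le> route_recourse I p)"

definition feasible_paths :: "'w vrpsd \<Rightarrow> nat list set" where
  "feasible_paths I =
     {p \<in> paths I. (\<Sum>i\<in>set p. mean_demand I i) \<le> load_factor I * capacity I}"

definition path_recourse :: "'w vrpsd \<Rightarrow> nat list \<Rightarrow> real" where
  "path_recourse I p = min (route_recourse I p) (route_recourse I (rev p))"

text \<open>No disjointness condition is needed here: a concatenation that is a path is distinct.\<close>

definition superadditive_recourse :: "'w vrpsd \<Rightarrow> bool" where
  "superadditive_recourse I \<longleftrightarrow>
     (\<forall>p1\<in>feasible_paths I. \<forall>p2\<in>feasible_paths I. p1 @ p2 \<in> feasible_paths I \<longrightarrow>
        path_recourse I (p1 @ p2) \<ge> path_recourse I p1 + path_recourse I p2)"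


section \<open>First-stage solutions\<close>

text \<open>\<open>inj_on set\<close> rules out two paths on the same customers (say, a path and its reverse),
  which the image \<open>set ` \<pi>\<close> would merge into one block of the partition.\<close>

definition path_partitions :: "'w vrpsd \<Rightarrow> nat set \<Rightarrow> nat \<Rightarrow> nat list set set" where
  "path_partitions I S m =
     {\<pi>. \<pi> \<subseteq> feasible_paths I \<and> finite \<pi> \<and> card \<pi> = m \<and>
         inj_on set \<pi> \<and> partition_on S (set ` \<pi>)}"

text \<open>The multiplicity of an edge in the closed walk \<open>(0, p, 0)\<close>. For \<open>p = [i]\<close> the depot edge
  \<open>{0, i}\<close> is traversed, and counted, twice.\<close>

definition route_multiplicity :: "nat list \<Rightarrow> nat set \<Rightarrow> nat" where
  "route_multiplicity p e = count_list (map2 (\<lambda>i j. {i, j}) (0 # p) (p @ [0])) e"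

definition edge_vector :: "nat list set \<Rightarrow> nat set \<Rightarrow> nat" where
  "edge_vector \<pi> e = (\<Sum>p\<in>\<pi>. route_multiplicity p e)"

definition first_stage_solutions :: "'w vrpsd \<Rightarrow> nat set \<Rightarrow> (nat set \<Rightarrow> nat) set" where
  "first_stage_solutions I M =
     {edge_vector \<pi> | \<pi> m. m \<in> M \<and> \<pi> \<in> path_partitions I (customers I) m}"

text \<open>A solution determines its paths up to orientation, and \<^const>\<open>path_recourse\<close> does not
  depend on the orientation, so the choice below does not affect \<open>solution_recourse\<close>.\<close>

definition solution_paths :: "'w vrpsd \<Rightarrow> (nat set \<Rightarrow> nat) \<Rightarrow> nat list set" where
  "solution_paths I x =
     (SOME \<pi>. (\<exists>m. \<pi> \<in> path_partitions I (customers I) m) \<and> edge_vector \<pi> = x)"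

definition solution_recourse :: "'w vrpsd \<Rightarrow> (nat set \<Rightarrow> nat) \<Rightarrow> real" where
  "solution_recourse I x = (\<Sum>p\<in>solution_paths I x. path_recourse I p)"


section \<open>The DL-shaped model\<close>

definition path_value :: "nat list \<Rightarrow> (nat set \<Rightarrow> nat) \<Rightarrow> nat" where
  "path_value p x = (\<Sum>j<length p - 1. x {p ! j, p ! Suc j})"

text \<open>The set of admissible \<open>m\<close> is nonempty in every instance and for every set \<open>S\<close> of customers,
  since each single customer forms a feasible path.\<close>

definition min_paths :: "'w vrpsd \<Rightarrow> nat set \<Rightarrow> nat" where
  "min_paths I S = (LEAST m. path_partitions I S m \<noteq> {})"

definition recourse_bound :: "'w vrpsd \<Rightarrow> nat set \<Rightarrow> nat \<Rightarrow> ereal" where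
  "recourse_bound I S m =
     (if path_partitions I S m = {} then \<infinity>
      else ereal (Min ((\<lambda>\<pi>. \<Sum>p\<in>\<pi>. path_recourse I p) ` path_partitions I S m)))"

definition admissible_S_cut_data ::
    "'w vrpsd \<Rightarrow> nat set set \<Rightarrow> (nat set \<Rightarrow> nat) \<Rightarrow> (nat set \<Rightarrow> real) \<Rightarrow> bool" where
  "admissible_S_cut_data I \<S> m L \<longleftrightarrow>
     (\<forall>S\<in>\<S>. S \<noteq> {} \<and> S \<subseteq> customers I \<and> 1 \<le> m S \<and> m S \<le> min_paths I S \<and>
        0 \<le> L S \<and> ereal (L S) \<le> recourse_bound I S (m S))"

definition P_cuts :: "'w vrpsd \<Rightarrow> (nat set \<Rightarrow> nat) \<Rightarrow> (nat \<Rightarrow> real) \<Rightarrow> bool" where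
  "P_cuts I x \<theta> \<longleftrightarrow>
     (\<forall>p\<in>feasible_paths I.
        (\<Sum>i\<in>set p. \<theta> i) \<ge>
          path_recourse I p * (real (path_value p x) - real (card (set p)) + 2))"

definition S_cuts ::
    "nat set set \<Rightarrow> (nat set \<Rightarrow> nat) \<Rightarrow> (nat set \<Rightarrow> real) \<Rightarrow> (nat set \<Rightarrow> nat) \<Rightarrow> (nat \<Rightarrow> real) \<Rightarrow> bool"
  where
  "S_cuts \<S> m L x \<theta> \<longleftrightarrow>
     (\<forall>S\<in>\<S>. (\<Sum>i\<in>S. \<theta> i) \<ge>
        L S * (real (\<Sum>e\<in>edges S. x e) - real (card S) + real (m S) + 1))"

definition MP_feasible ::
    "'w vrpsd \<Rightarrow> nat set \<Rightarrow> nat set set \<Rightarrow> (nat set \<Rightarrow> nat) \<Rightarrow> (nat set \<Rightarrow> real) \<Rightarrow>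
     (nat set \<Rightarrow> nat) \<Rightarrow> (nat \<Rightarrow> real) \<Rightarrow> bool" where
  "MP_feasible I M \<S> m L x \<theta> \<longleftrightarrow>
     x \<in> first_stage_solutions I M \<and> P_cuts I x \<theta> \<and> S_cuts \<S> m L x \<theta> \<and>
     (\<forall>i\<in>customers I. 0 \<le> \<theta> i)"

definition valid_reformulation ::
    "'w vrpsd \<Rightarrow> nat set \<Rightarrow> nat set set \<Rightarrow> (nat set \<Rightarrow> nat) \<Rightarrow> (nat set \<Rightarrow> real) \<Rightarrow> bool" where
  "valid_reformulation I M \<S> m L \<longleftrightarrow>
     (\<forall>x\<in>first_stage_solutions I M. \<exists>\<theta>.
        is_arg_min (\<lambda>\<theta>. \<Sum>i\<in>customers I. \<theta> i) (MP_feasible I M \<S> m L x) \<theta> \<and>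
        (\<Sum>i\<in>customers I. \<theta> i) = solution_recourse I x)"

end

(* For a feasible solution x, the P-cut of a path p is active only when p is, up to reversal, a
   contiguous piece of one of the paths of x; it then reads theta(p) >= Q_p. Applied to the paths of
   x themselves this gives sum theta >= Q(x). Under superadditivity the telescoping prices
   theta_{i_j} = Q_{(i_1..i_j)} - Q_{(i_1..i_{j-1})} attain this bound and satisfy the P-cut of every
   piece. They also satisfy the S-cuts: S splits the paths of x into k >= m(S) pieces, the right-hand
   side is L_S (m_S - k + 1), and if it is positive then k = m_S and L_S is at most the total
   recourse of the pieces. Conversely, if p1, p2 violate superadditivity, the solution consisting of
   (p1, p2) and single-customer routes has pieces p1, p2 whose P-cuts force sum theta > Q(x). *)

theory Submission imports Defs "HOL-Library.Sublist" begin

section \<open>Edges of a path\<close>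

text \<open>Customer edges only: the two depot edges of a route are excluded, as in p(x) and
  E(S).\<close>

fun path_edges :: "'a list \<Rightarrow> 'a set set" where
  "path_edges [] = {}"
| "path_edges [a] = {}"
| "path_edges (a # b # p) = insert {a, b} (path_edges (b # p))"

lemma path_edges_subset: "e \<in> path_edges p \<Longrightarrow> e \<subseteq> set p \<and> e \<noteq> {}"
  by (induction p rule: path_edges.induct) auto

lemma finite_path_edges [simp]: "finite (path_edges p)"
  by (induction p rule: path_edges.induct) auto

lemma path_edges_fresh: "a \<notin> set p \<Longrightarrow> {a, b} \<notin> path_edges p"
  using path_edges_subset[of "{a, b}" p] by auto

lemma card_path_edges:
  assumes "distinct p" "p \<noteq> []"
  shows "Suc (card (path_edges p)) = length p"
  using assms
proof (induction p rule: path_edges.induct)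
  case (3 a b p)
  then show ?case using path_edges_fresh[of a "b # p" b] by simp
qed auto

text \<open>Membership becomes a decomposition of the list, which turns reversal and concatenation
  into list algebra.\<close>

lemma path_edges_split:
  "e \<in> path_edges p \<longleftrightarrow> (\<exists>us a b vs. p = us @ a # b # vs \<and> e = {a, b})"
proof (induction p rule: path_edges.induct)
  case (3 a b p)
  show ?case
  proof
    assume "e \<in> path_edges (a # b # p)"
    then consider "e = {a, b}" | "e \<in> path_edges (b # p)" by auto
    then show "\<exists>us c d vs. a # b # p = us @ c # d # vs \<and> e = {c, d}"
    proof cases
      case 1
      have "a # b # p = [] @ a # b # p" by simp
      with 1 show ?thesis by blast
    next
      case 2
      then obtain us c d vs where "b # p = us @ c # d # vs" "e = {c, d}"
        using 3 by blast
      then have "a # b # p = (a # us) @ c # d # vs \<and> e = {c, d}" by simp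
      then show ?thesis by blast
    qed
  next
    assume "\<exists>us c d vs. a # b # p = us @ c # d # vs \<and> e = {c, d}"
    then obtain us c d vs where *: "a # b # p = us @ c # d # vs" "e = {c, d}" by blast
    show "e \<in> path_edges (a # b # p)"
    proof (cases us)
      case Nil
      with * show ?thesis by simp
    next
      case (Cons u us')
      with * have "b # p = us' @ c # d # vs" by simp
      with *(2) 3 have "e \<in> path_edges (b # p)" by blast
      then show ?thesis by simp
    qed
  qed
qed auto

lemma path_edges_rev: "path_edges (rev p) = path_edges p"
proof -
  have "path_edges q \<subseteq> path_edges (rev q)" for q :: "'a list"
  proof
    fix e assume "e \<in> path_edges q"
    then obtain us a b vs where "q = us @ a # b # vs" "e = {a, b}"
      by (auto simp: path_edges_split)
    then have "rev q = rev vs @ b # a # rev us \<and> e = {b, a}" by auto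
    then show "e \<in> path_edges (rev q)" unfolding path_edges_split by blast
  qed
  from this[of p] this[of "rev p"] show ?thesis by auto
qed

lemma distinct_split_unique:
  assumes "us @ a # vs = us' @ a # vs'" "distinct (us @ a # vs)"
  shows "us = us' \<and> vs = vs'"
  using assms
proof (induction us arbitrary: us')
  case Nil
  then show ?case by (cases us') auto
next
  case (Cons u us)
  then show ?case by (cases us') auto
qed

text \<open>Since q is distinct, b has a single position in it. If a stands just before b, the piece
  grows to the left. If a stands just after b, then \<open>p\<close> must be empty, because
  otherwise it would start with a; the edge is then a piece read backwards.\<close>

lemma sublist_extend:
  assumes q: "distinct q" and sub: "sublist (b # p) q"
    and e: "{a, b} \<in> path_edges q" and a: "a \<notin> set (b # p)"
  shows "sublist (a # b # p) q \<or> sublist (rev (a # b # p)) q"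
proof -
  obtain us vs where uv: "q = us @ b # p @ vs"
    using sub by (auto simp: sublist_def)
  obtain xs c d ys where xy: "q = xs @ c # d # ys" "{a, b} = {c, d}"
    using e by (auto simp: path_edges_split)
  from xy(2) consider "a = c" "b = d" | "b = c" "a = d"
    by (auto simp: doubleton_eq_iff)
  then show ?thesis
  proof cases
    case 1
    then have "q = (xs @ [a]) @ b # ys" using xy by simp
    then have "us = xs @ [a]" using uv q distinct_split_unique by metis
    then have "q = xs @ (a # b # p) @ vs" using uv by simp
    then show ?thesis unfolding sublist_def by blast
  next
    case 2
    then have "q = xs @ b # (a # ys)" using xy by simp
    then have ys: "us = xs" "p @ vs = a # ys" using uv q distinct_split_unique by metis+
    then have "p = []" using a by (cases p) auto
    then have "q = xs @ rev (a # b # p) @ ys" using uv ys by simp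
    then show ?thesis unfolding sublist_def by blast
  qed
qed

text \<open>Induction adding one vertex in front: the new edge shares b with the piece found so far,
  so disjointness puts it into the same path q, and \<open>sublist_extend\<close> applies to q or to
  its reverse.\<close>

lemma sublist_of_path_edges:
  assumes "p \<noteq> []" "distinct p" "set p \<subseteq> \<Union> (set ` \<pi>)"
    and "path_edges p \<subseteq> \<Union> (path_edges ` \<pi>)"
    and dist: "\<forall>q\<in>\<pi>. distinct q"
    and disj: "\<And>q r i. q \<in> \<pi> \<Longrightarrow> r \<in> \<pi> \<Longrightarrow> i \<in> set q \<Longrightarrow> i \<in> set r \<Longrightarrow> q = r"
  shows "\<exists>q\<in>\<pi>. sublist p q \<or> sublist (rev p) q"
  using assms(1-4)
proof (induction p rule: path_edges.induct)
  case (2 a)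
  then obtain q where "q \<in> \<pi>" "a \<in> set q" by auto
  then have "sublist [a] q" by (metis sublist_def split_list append_Cons append_Nil)
  with \<open>q \<in> \<pi>\<close> show ?case by blast
next
  case (3 a b p)
  then obtain q where q: "q \<in> \<pi>" "sublist (b # p) q \<or> sublist (rev (b # p)) q" by auto
  from 3 obtain r where r: "r \<in> \<pi>" "{a, b} \<in> path_edges r" by auto
  have "b \<in> set r" using path_edges_subset[OF r(2)] by auto
  moreover have "b \<in> set q" using q(2) set_mono_sublist by fastforce
  ultimately have e: "{a, b} \<in> path_edges q" using disj q(1) r by blast
  have dq: "distinct q" and a: "a \<notin> set (b # p)" using dist q(1) 3 by auto
  from q(2) show ?case
  proof
    assume "sublist (b # p) q"
    then show ?thesis using sublist_extend[OF dq _ e a] q(1) by blast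
  next
    assume "sublist (rev (b # p)) q"
    then have "sublist (b # p) (rev q)" by (metis sublist_rev rev_rev_ident)
    then have "sublist (a # b # p) (rev q) \<or> sublist (rev (a # b # p)) (rev q)"
      using sublist_extend[of "rev q" b p a] dq e a by (simp add: path_edges_rev)
    then have "sublist (rev (a # b # p)) q \<or> sublist (a # b # p) q"
      by (metis sublist_rev rev_rev_ident)
    then show ?thesis using q(1) by blast
  qed
qed simp

section \<open>Runs of a path inside a customer set\<close>

lemma in_edges_iff: "a \<noteq> b \<Longrightarrow> {a, b} \<in> edges S \<longleftrightarrow> a \<in> S \<and> b \<in> S"
  by (auto simp: edges_def doubleton_eq_iff)

lemma finite_edges: "finite S \<Longrightarrow> finite (edges S)"
  by (rule finite_subset[of _ "Pow S"]) (auto simp: edges_def)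

text \<open>The lists in \<open>rs\<close> are the maximal contiguous runs of q inside S. A run has
  one edge fewer than vertices, whence the counting identity. The last conjunct strengthens the
  induction: a new head may be joined to the first run only if that run starts at the head of
  q.\<close>

lemma runs_exist:
  assumes "distinct q"
  shows "\<exists>rs. concat rs = filter (\<lambda>i. i \<in> S) q \<and> [] \<notin> set rs \<and> (\<forall>r\<in>set rs. sublist r q)
    \<and> length rs + card (path_edges q \<inter> edges S) = card (S \<inter> set q)
    \<and> (q \<noteq> [] \<longrightarrow> hd q \<in> S \<longrightarrow> rs \<noteq> [] \<and> prefix (hd rs) q)"
  using assms
proof (induction q)
  case Nil
  then show ?case by (intro exI[of _ "[]"]) simp
next
  case (Cons a q)
  then obtain rs where rs: "concat rs = filter (\<lambda>i. i \<in> S) q" "[] \<notin> set rs"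
      "\<forall>r\<in>set rs. sublist r q"
      "length rs + card (path_edges q \<inter> edges S) = card (S \<inter> set q)"
      "q \<noteq> [] \<longrightarrow> hd q \<in> S \<longrightarrow> rs \<noteq> [] \<and> prefix (hd rs) q" by auto
  have sub: "\<forall>r\<in>set rs. sublist r (a # q)" using rs(3) by (auto simp: sublist_Cons_right)
  have aq: "a \<notin> set q" using Cons by simp
  show ?case
  proof (cases "a \<in> S")
    case False
    have "path_edges (a # q) \<inter> edges S = path_edges q \<inter> edges S"
    proof (cases q)
      case (Cons b p)
      then show ?thesis using False aq in_edges_iff[of a b S] by auto
    qed simp
    with False rs sub show ?thesis by (intro exI[of _ rs]) auto
  next
    case a: True
    then have S: "card (S \<inter> set (a # q)) = Suc (card (S \<inter> set q))" using aq by simp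
    \<comment> \<open>If the next vertex is missing or outside S, a opens a run of its own;
      otherwise it prolongs the first run and contributes the edge {a, b}.\<close>
    show ?thesis
    proof (cases "q \<noteq> [] \<and> hd q \<in> S")
      case False
      have "path_edges (a # q) \<inter> edges S = path_edges q \<inter> edges S"
      proof (cases q)
        case (Cons b p)
        then show ?thesis using False aq in_edges_iff[of a b S] by auto
      qed simp
      with a rs sub S show ?thesis
        by (intro exI[of _ "[a] # rs"]) (auto simp: sublist_Cons_right)
    next
      case True
      then obtain b p where q: "q = b # p" by (cases q) auto
      then have b: "b \<in> S" using True by simp
      have "prefix (hd rs) q" "rs \<noteq> []" using rs(5) True by auto
      then obtain r rs' where r: "rs = r # rs'" "prefix r q" by (cases rs) auto
      have "path_edges (a # q) \<inter> edges S = insert {a, b} (path_edges q \<inter> edges S)"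
        using a b aq q in_edges_iff[of a b S] by auto
      moreover have "{a, b} \<notin> path_edges q" using path_edges_fresh[OF aq] .
      ultimately have "card (path_edges (a # q) \<inter> edges S) = Suc (card (path_edges q \<inter> edges S))"
        by simp
      with a rs sub S r show ?thesis
        by (intro exI[of _ "(a # r) # rs'"]) (auto simp: sublist_Cons_right)
    qed
  qed
qed


section \<open>Edge vectors\<close>

text \<open>The walk starts at an arbitrary vertex instead of the depot to let the induction move
  along it. The condition \<open>0 \<notin> e\<close> discards the closing edge, and distinctness
  keeps any other edge from being traversed twice.\<close>

lemma count_list_closed_walk:
  assumes "distinct (a # p)" "0 \<notin> e"
  shows "count_list (map2 (\<lambda>i j. {i, j}) (a # p) (p @ [0])) e =
    (if e \<in> path_edges (a # p) then 1 else 0)"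
  using assms(1)
proof (induction p arbitrary: a)
  case Nil
  then show ?case using assms(2) by auto
next
  case (Cons b p)
  then have "{a, b} \<notin> path_edges (b # p)" by (intro path_edges_fresh) auto
  with Cons show ?case by auto
qed

lemma route_multiplicity_eq:
  assumes "distinct p" "0 \<notin> e"
  shows "route_multiplicity p e = (if e \<in> path_edges p then 1 else 0)"
proof (cases p)
  case Nil
  then show ?thesis using assms(2) by (auto simp: route_multiplicity_def)
next
  case (Cons b q)
  then show ?thesis using assms count_list_closed_walk[of b q e]
    by (auto simp: route_multiplicity_def)
qed

lemma path_value_eq_sum:
  "distinct p \<Longrightarrow> path_value p x = (\<Sum>e\<in>path_edges p. x e)"
proof (induction p rule: path_edges.induct)
  case (3 a b p)
  then have "{a, b} \<notin> path_edges (b # p)" by (intro path_edges_fresh) auto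
  moreover have "path_value (a # b # p) x = x {a, b} + path_value (b # p) x"
    by (simp add: path_value_def sum.lessThan_Suc_shift del: sum.lessThan_Suc)
  ultimately show ?case using 3 by simp
qed (auto simp: path_value_def)

section \<open>Path partitions, their edge vectors and the factor of a P-cut\<close>

lemma path_partitions_disjoint:
  assumes "\<pi> \<in> path_partitions I S k" "q \<in> \<pi>" "r \<in> \<pi>" "i \<in> set q" "i \<in> set r"
  shows "q = r"
proof -
  have "inj_on set \<pi>" "partition_on S (set ` \<pi>)"
    using assms(1) by (auto simp: path_partitions_def)
  \<comment> \<open>Overlapping blocks of a partition coincide; \<open>inj_on set\<close> then lifts
    this from customer sets to paths.\<close>
  moreover have "set q = set r"
    using assms calculation(2) by (auto simp: partition_on_def disjoint_def)
  ultimately show ?thesis using assms by (auto dest: inj_onD)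
qed

lemma path_partitionsD:
  assumes "\<pi> \<in> path_partitions I S k"
  shows "finite \<pi>" "\<pi> \<subseteq> feasible_paths I" "\<Union> (set ` \<pi>) = S" "\<forall>q\<in>\<pi>. distinct q \<and> q \<noteq> []"
  using assms by (auto simp: path_partitions_def partition_on_def feasible_paths_def paths_def)

lemma sum_path_partition:
  assumes "\<pi> \<in> path_partitions I S k"
  shows "(\<Sum>i\<in>S. f i) = (\<Sum>p\<in>\<pi>. \<Sum>i\<in>set p. f i)"
  unfolding path_partitionsD(3)[OF assms, symmetric]
  by (rule sum.UNION_disjoint)
    (use path_partitionsD(1)[OF assms] path_partitions_disjoint[OF assms] in blast)+

text \<open>An edge of a path has an endpoint that lies in only one path of the partition, so at
  most one summand is nonzero.\<close>

lemma edge_vector_eq: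
  assumes "\<pi> \<in> path_partitions I S k" "0 \<notin> e"
  shows "edge_vector \<pi> e = (if e \<in> \<Union> (path_edges ` \<pi>) then 1 else 0)"
proof -
  note D = path_partitionsD[OF assms(1)]
  have "edge_vector \<pi> e = (\<Sum>p\<in>\<pi>. if e \<in> path_edges p then 1 else 0)"
    unfolding edge_vector_def by (rule sum.cong) (use D assms(2) route_multiplicity_eq in auto)
  also have "\<dots> = card {p \<in> \<pi>. e \<in> path_edges p}"
    using D(1) by (simp add: sum.If_cases Int_def)
  also have "\<dots> = (if e \<in> \<Union> (path_edges ` \<pi>) then 1 else 0)"
  proof (cases "e \<in> \<Union> (path_edges ` \<pi>)")
    case True
    then obtain p where p: "p \<in> \<pi>" "e \<in> path_edges p" by auto
    have "q = p" if q: "q \<in> \<pi>" "e \<in> path_edges q" for q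
    proof -
      obtain i where "i \<in> e" using path_edges_subset[OF p(2)] by blast
      then show ?thesis
        using path_partitions_disjoint[OF assms(1) q(1) p(1)] path_edges_subset p(2) q(2) by blast
    qed
    then have "{p \<in> \<pi>. e \<in> path_edges p} = {p}" using p by blast
    then show ?thesis using True by simp
  next
    case False
    then have "{p \<in> \<pi>. e \<in> path_edges p} = {}" by auto
    then show ?thesis using False by (simp only: card.empty if_False)
  qed
  finally show ?thesis .
qed

lemma sum_edge_vector:
  assumes "\<pi> \<in> path_partitions I S k" "finite E" "\<And>e. e \<in> E \<Longrightarrow> 0 \<notin> e"
  shows "(\<Sum>e\<in>E. edge_vector \<pi> e) = card (E \<inter> \<Union> (path_edges ` \<pi>))"
proof -
  have "(\<Sum>e\<in>E. edge_vector \<pi> e) = (\<Sum>e\<in>E. if e \<in> \<Union> (path_edges ` \<pi>) then 1 else 0)"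
    by (intro sum.cong refl edge_vector_eq[OF assms(1)] assms(3))
  also have "\<dots> = card (E \<inter> \<Union> (path_edges ` \<pi>))"
    using assms(2) by (simp only: sum.If_cases) (simp add: Int_def)
  finally show ?thesis .
qed

lemma feasible_pathsD:
  assumes "p \<in> feasible_paths I"
  shows "p \<noteq> []" "distinct p" "set p \<subseteq> customers I" "0 \<notin> set p"
  using assms by (auto simp: feasible_paths_def paths_def customers_def)

lemma path_value_edge_vector:
  assumes "\<pi> \<in> path_partitions I S k" "p \<in> feasible_paths I"
  shows "path_value p (edge_vector \<pi>) = card (path_edges p \<inter> \<Union> (path_edges ` \<pi>))"
  unfolding path_value_eq_sum[OF feasible_pathsD(2)[OF assms(2)]]
  by (rule sum_edge_vector[OF assms(1)])
    (use path_edges_subset feasible_pathsD[OF assms(2)] in auto)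

text \<open>When x uses every edge of p, p(x) is |N(p)| - 1, so the P-cut reads sum of \<theta> over
  p >= Q_p.\<close>

lemma path_value_own:
  assumes "\<pi> \<in> path_partitions I S k" "p \<in> feasible_paths I"
    and "path_edges p \<subseteq> \<Union> (path_edges ` \<pi>)"
  shows "real (path_value p (edge_vector \<pi>)) - real (card (set p)) + 2 = 1"
proof -
  have "path_edges p \<inter> \<Union> (path_edges ` \<pi>) = path_edges p" using assms(3) by auto
  then show ?thesis
    using path_value_edge_vector[OF assms(1,2)] card_path_edges[of p] feasible_pathsD[OF assms(2)]
      distinct_card[of p] by simp
qed

text \<open>A single missing edge already lowers p(x) to at most |N(p)| - 2, so the cut follows from
  the signs of Q_p and \<theta>.\<close>

lemma path_value_other:
  assumes "\<pi> \<in> path_partitions I S k" "p \<in> feasible_paths I"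
    and "\<not> path_edges p \<subseteq> \<Union> (path_edges ` \<pi>)"
  shows "real (path_value p (edge_vector \<pi>)) - real (card (set p)) + 2 \<le> 0"
proof -
  have "card (path_edges p \<inter> \<Union> (path_edges ` \<pi>)) < card (path_edges p)"
    by (rule psubset_card_mono) (use assms(3) in auto)
  then show ?thesis
    using path_value_edge_vector[OF assms(1,2)] card_path_edges[of p] feasible_pathsD[OF assms(2)]
      distinct_card[of p] by simp
qed

section \<open>Finiteness and closure properties of feasible paths\<close>

lemma finite_feasible_paths: "finite (feasible_paths I)"
proof (rule finite_subset)
  show "feasible_paths I \<subseteq> {p. set p \<subseteq> customers I \<and> length p \<le> card (customers I)}"
    using feasible_pathsD[of _ I] card_mono[of "customers I"]
    by (auto simp: distinct_card[symmetric] customers_def)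
  show "finite {p. set p \<subseteq> customers I \<and> length p \<le> card (customers I)}"
    by (rule finite_lists_length_le) (simp add: customers_def)
qed

text \<open>Makes the \<open>Min\<close> in \<open>recourse_bound\<close> a genuine minimum.\<close>

lemma finite_path_partitions: "finite (path_partitions I S k)"
  by (rule finite_subset[of _ "Pow (feasible_paths I)"])
    (auto simp: path_partitions_def finite_feasible_paths)

lemma path_recourse_rev: "path_recourse I (rev p) = path_recourse I p"
  by (simp add: path_recourse_def min.commute)

lemma rev_feasible: "p \<in> feasible_paths I \<Longrightarrow> rev p \<in> feasible_paths I"
  by (simp add: feasible_paths_def paths_def)

lemma path_recourse_nonneg:
  assumes "vrpsd_instance I" "p \<in> feasible_paths I"
  shows "0 \<le> path_recourse I p"
  using assms rev_feasible[OF assms(2)]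
  by (auto simp: path_recourse_def vrpsd_instance_def feasible_paths_def)

lemma mean_demand_nonneg:
  assumes "vrpsd_instance I" "i \<in> customers I"
  shows "0 \<le> mean_demand I i"
  unfolding mean_demand_def
  by (rule integral_nonneg_AE) (use assms in \<open>auto simp: vrpsd_instance_def\<close>)

text \<open>Mean demands are nonnegative, so passing to a piece cannot increase the load.\<close>

lemma sublist_feasible:
  assumes "vrpsd_instance I" "q \<in> feasible_paths I" "sublist p q" "p \<noteq> []"
  shows "p \<in> feasible_paths I"
proof -
  have sub: "set p \<subseteq> set q" using assms(3) by (rule set_mono_sublist)
  have "(\<Sum>i\<in>set p. mean_demand I i) \<le> (\<Sum>i\<in>set q. mean_demand I i)"
    by (rule sum_mono2) (use sub mean_demand_nonneg[OF assms(1)] feasible_pathsD[OF assms(2)] in auto)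
  moreover have "distinct p" using feasible_pathsD(2)[OF assms(2)] assms(3) by (auto simp: sublist_def)
  ultimately show ?thesis using assms sub by (auto simp: feasible_paths_def paths_def)
qed

lemma singleton_feasible:
  assumes "vrpsd_instance I" "i \<in> customers I"
  shows "[i] \<in> feasible_paths I"
  using assms by (auto simp: feasible_paths_def paths_def vrpsd_instance_def)

text \<open>Identifies the paths with P-cut factor 1: up to reversal, they are pieces of paths of
  the solution.\<close>

lemma edge_vector_sublist:
  assumes "\<pi> \<in> path_partitions I (customers I) k" "p \<in> feasible_paths I"
    and "path_edges p \<subseteq> \<Union> (path_edges ` \<pi>)"
  shows "\<exists>q\<in>\<pi>. sublist p q \<or> sublist (rev p) q"
proof (rule sublist_of_path_edges)
  show "set p \<subseteq> \<Union> (set ` \<pi>)"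
    using feasible_pathsD(3)[OF assms(2)] path_partitionsD(3)[OF assms(1)] by simp
  show "\<forall>q\<in>\<pi>. distinct q" using path_partitionsD(4)[OF assms(1)] by blast
qed (use assms feasible_pathsD[OF assms(2)] path_partitions_disjoint[OF assms(1)] in blast)+


section \<open>A solution determines its paths up to orientation\<close>

lemma edge_vector_eq_path_edges:
  assumes "\<pi> \<in> path_partitions I S k" "\<rho> \<in> path_partitions I T l" "edge_vector \<pi> = edge_vector \<rho>"
  shows "\<Union> (path_edges ` \<pi>) = \<Union> (path_edges ` \<rho>)"
proof -
  have "e \<in> \<Union> (path_edges ` \<pi>) \<longleftrightarrow> e \<in> \<Union> (path_edges ` \<rho>)" for e
  proof (cases "0 \<in> e")
    \<comment> \<open>Depot edges lie in no \<open>path_edges\<close> of a feasible path, so both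
      memberships fail.\<close>
    case True
    have "e \<notin> path_edges p" if "p \<in> feasible_paths I" for p
      using True path_edges_subset[of e p] feasible_pathsD(4)[OF that] by blast
    then show ?thesis
      using path_partitionsD(2)[OF assms(1)] path_partitionsD(2)[OF assms(2)] by blast
  next
    case False
    then show ?thesis
      using edge_vector_eq[OF assms(1) False] edge_vector_eq[OF assms(2) False] assms(3)
      by (metis zero_neq_one)
  qed
  then show ?thesis by blast
qed

text \<open>Going there and back: p is a piece of some q in \<rho>, and q is a piece of some r in
  \<pi>, up to reversal. Then p and r share a customer, so p = r; hence p and q have equal length
  and agree up to reversal.\<close>

lemma edge_vector_orientation:
  assumes \<pi>: "\<pi> \<in> path_partitions I (customers I) k" and \<rho>: "\<rho> \<in> path_partitions I (customers I) l"
    and eq: "edge_vector \<pi> = edge_vector \<rho>" and p: "p \<in> \<pi>"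
  shows "p \<in> \<rho> \<or> rev p \<in> \<rho>"
proof -
  note E = edge_vector_eq_path_edges[OF \<pi> \<rho> eq]
  have fp: "p \<in> feasible_paths I" using path_partitionsD(2)[OF \<pi>] p by auto
  have "path_edges p \<subseteq> \<Union> (path_edges ` \<rho>)" using E p by auto
  then obtain q where q: "q \<in> \<rho>" "sublist p q \<or> sublist (rev p) q"
    using edge_vector_sublist[OF \<rho> fp] by auto
  have fq: "q \<in> feasible_paths I" using path_partitionsD(2)[OF \<rho>] q(1) by auto
  have "path_edges q \<subseteq> \<Union> (path_edges ` \<pi>)" using E q by auto
  then obtain r where r: "r \<in> \<pi>" "sublist q r \<or> sublist (rev q) r"
    using edge_vector_sublist[OF \<pi> fq] by auto
  have pq: "set p \<subseteq> set q" using q(2) set_mono_sublist by fastforce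
  have qr: "set q \<subseteq> set r" using r(2) set_mono_sublist by fastforce
  have "hd p \<in> set p" using feasible_pathsD(1)[OF fp] by simp
  then have "p = r" using path_partitions_disjoint[OF \<pi> p r(1), of "hd p"] pq qr by blast
  then have len: "length p \<ge> length q" using r(2) sublist_length_le by fastforce
  have "p = q \<or> rev p = q"
    using q(2) len by (auto simp: sublist_def)
  then show ?thesis using q(1) by auto
qed

lemma sum_path_recourse_unique:
  assumes \<pi>: "\<pi> \<in> path_partitions I (customers I) k" and \<rho>: "\<rho> \<in> path_partitions I (customers I) l"
    and eq: "edge_vector \<pi> = edge_vector \<rho>"
  shows "(\<Sum>p\<in>\<pi>. path_recourse I p) = (\<Sum>p\<in>\<rho>. path_recourse I p)"
proof (rule sum.reindex_bij_witness[where
      i = "\<lambda>p. if p \<in> \<pi> then p else rev p" and j = "\<lambda>p. if p \<in> \<rho> then p else rev p"])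
  \<comment> \<open>A path and its reverse share their customers, so a partition contains both only
    if they coincide. This makes the two reorienting maps inverse to each other.\<close>
  have pal: "rev p = p" if "p \<in> \<sigma>" "rev p \<in> \<sigma>" "\<sigma> \<in> path_partitions I S j" for p \<sigma> S j
    using that path_partitions_disjoint[OF that(3), of p "rev p" "hd p"] path_partitionsD(4)[OF that(3)]
    by auto
  show "(if (if p \<in> \<rho> then p else rev p) \<in> \<pi> then if p \<in> \<rho> then p else rev p
      else rev (if p \<in> \<rho> then p else rev p)) = p" if "p \<in> \<pi>" for p
    using that pal[OF _ _ \<pi>] by (auto split: if_splits)
  show "(if (if p \<in> \<pi> then p else rev p) \<in> \<rho> then if p \<in> \<pi> then p else rev p
      else rev (if p \<in> \<pi> then p else rev p)) = p" if "p \<in> \<rho>" for p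
    using that pal[OF _ _ \<rho>] by (auto split: if_splits)
qed (use edge_vector_orientation[OF \<pi> \<rho> eq] edge_vector_orientation[OF \<rho> \<pi> eq[symmetric]]
     in \<open>auto simp: path_recourse_rev\<close>)

lemma solution_paths_spec:
  assumes "\<pi> \<in> path_partitions I (customers I) k"
  shows "\<exists>l. solution_paths I (edge_vector \<pi>) \<in> path_partitions I (customers I) l"
    and "edge_vector (solution_paths I (edge_vector \<pi>)) = edge_vector \<pi>"
proof -
  have "\<exists>\<rho>. (\<exists>m. \<rho> \<in> path_partitions I (customers I) m) \<and> edge_vector \<rho> = edge_vector \<pi>"
    using assms by blast
  from someI_ex[OF this] show "\<exists>l. solution_paths I (edge_vector \<pi>) \<in> path_partitions I (customers I) l"
    and "edge_vector (solution_paths I (edge_vector \<pi>)) = edge_vector \<pi>"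
    unfolding solution_paths_def by blast+
qed

text \<open>Eliminates the choice in \<open>solution_paths\<close>: any partition producing the
  vector computes its recourse.\<close>

lemma solution_recourse_edge_vector:
  assumes "\<pi> \<in> path_partitions I (customers I) k"
  shows "solution_recourse I (edge_vector \<pi>) = (\<Sum>p\<in>\<pi>. path_recourse I p)"
  unfolding solution_recourse_def
  using solution_paths_spec[OF assms] sum_path_recourse_unique assms by blast


section \<open>Superadditivity implies validity\<close>

text \<open>The price of a customer is the increase of recourse when the prefix before it is
  extended by it. Over a piece r that follows the prefix us, prices sum to Q(us @ r) - Q(us), which
  superadditivity bounds below by Q(r).\<close>

lemma path_prices:
  assumes I: "vrpsd_instance I" and sup: "superadditive_recourse I" and q: "q \<in> feasible_paths I"
  shows "\<exists>\<theta>. (\<forall>r. r \<noteq> [] \<longrightarrow> sublist r q \<longrightarrow> path_recourse I r \<le> (\<Sum>i\<in>set r. \<theta> i))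
    \<and> (\<Sum>i\<in>set q. \<theta> i) = path_recourse I q"
proof -
  \<comment> \<open>The empty prefix must cost 0 for the telescoping sum to end correctly; an
    instance does not fix the recourse of \<open>[]\<close>.\<close>
  define W where "W p = (if p = [] then 0 else path_recourse I p)" for p
  \<comment> \<open>Customers in q are distinct, so \<open>takeWhile\<close> recovers the prefix
    before i and the price depends on the customer alone.\<close>
  define \<theta> where "\<theta> i = (let us = takeWhile (\<lambda>j. j \<noteq> i) q in W (us @ [i]) - W us)" for i
  \<comment> \<open>Induction from the right end of r keeps the prefix us fixed and moves the
    removed customer into vs.\<close>
  have telescope: "(\<Sum>i\<in>set r. \<theta> i) = W (us @ r) - W us" if "q = us @ r @ vs" for us r vs
    using that
  proof (induction r arbitrary: vs rule: rev_induct)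
    case (snoc i r)
    have "distinct (us @ (r @ [i]) @ vs)" using feasible_pathsD(2)[OF q] snoc.prems by simp
    then have "i \<notin> set us" "i \<notin> set r" by auto
    then have "takeWhile (\<lambda>j. j \<noteq> i) ((us @ r) @ i # vs) = us @ r"
      by (subst takeWhile_append2) auto
    then have "takeWhile (\<lambda>j. j \<noteq> i) q = us @ r" by (simp add: snoc.prems)
    then have "\<theta> i = W (us @ r @ [i]) - W (us @ r)" by (simp add: \<theta>_def)
    moreover have "(\<Sum>i\<in>set r. \<theta> i) = W (us @ r) - W us" using snoc by simp
    ultimately show ?case using \<open>i \<notin> set r\<close> by simp
  qed simp
  have "path_recourse I r \<le> (\<Sum>i\<in>set r. \<theta> i)" if r: "r \<noteq> []" "sublist r q" for r
  proof -
    obtain us vs where uv: "q = us @ r @ vs" using r(2) by (auto simp: sublist_def)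
    \<comment> \<open>Superadditivity speaks of nonempty paths; for an empty prefix the inequality
      is an equality because \<open>W []\<close> is 0.\<close>
    have "W us + W r \<le> W (us @ r)"
    proof (cases "us = []")
      case False
      have "us \<in> feasible_paths I" "r \<in> feasible_paths I" "us @ r \<in> feasible_paths I"
        by (rule sublist_feasible[OF I q]; use uv r False in \<open>force simp: sublist_def\<close>)+
      then show ?thesis using sup False r(1) by (simp add: W_def superadditive_recourse_def)
    qed (simp add: W_def)
    then show ?thesis using telescope[OF uv] r(1) by (simp add: W_def)
  qed
  moreover have "(\<Sum>i\<in>set q. \<theta> i) = path_recourse I q"
    using telescope[of "[]" q "[]"] feasible_pathsD(1)[OF q] by (simp add: W_def)
  ultimately show ?thesis by blast
qed

lemma partition_prices:
  assumes I: "vrpsd_instance I" and sup: "superadditive_recourse I"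
    and \<pi>: "\<pi> \<in> path_partitions I S k"
  obtains \<theta> where
    "\<And>q r. q \<in> \<pi> \<Longrightarrow> r \<noteq> [] \<Longrightarrow> sublist r q \<Longrightarrow> path_recourse I r \<le> (\<Sum>i\<in>set r. \<theta> i)"
    "\<And>q. q \<in> \<pi> \<Longrightarrow> (\<Sum>i\<in>set q. \<theta> i) = path_recourse I q"
proof -
  have "\<forall>q\<in>\<pi>. \<exists>\<theta>. (\<forall>r. r \<noteq> [] \<longrightarrow> sublist r q \<longrightarrow> path_recourse I r \<le> (\<Sum>i\<in>set r. \<theta> i))
    \<and> (\<Sum>i\<in>set q. \<theta> i) = path_recourse I q"
    using path_prices[OF I sup] path_partitionsD(2)[OF \<pi>] by blast
  then obtain T where T: "\<forall>q\<in>\<pi>. (\<forall>r. r \<noteq> [] \<longrightarrow> sublist r q \<longrightarrow>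
      path_recourse I r \<le> (\<Sum>i\<in>set r. T q i)) \<and> (\<Sum>i\<in>set q. T q i) = path_recourse I q"
    by metis
  \<comment> \<open>The prices of the individual paths are glued together; each customer takes its
    price from the unique path containing it.\<close>
  define \<theta> where "\<theta> i = T (THE q. q \<in> \<pi> \<and> i \<in> set q) i" for i
  have "(THE q. q \<in> \<pi> \<and> i \<in> set q) = q" if "q \<in> \<pi>" "i \<in> set q" for i q
    using that path_partitions_disjoint[OF \<pi>] by (intro the_equality) blast+
  then have eq: "(\<Sum>i\<in>set r. \<theta> i) = (\<Sum>i\<in>set r. T q i)" if "q \<in> \<pi>" "set r \<subseteq> set q" for q r
    using that by (intro sum.cong) (auto simp: \<theta>_def)
  show thesis
  proof (rule that[of \<theta>])
    show "path_recourse I r \<le> (\<Sum>i\<in>set r. \<theta> i)" if "q \<in> \<pi>" "r \<noteq> []" "sublist r q" for q r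
      using that T eq[OF that(1) set_mono_sublist[OF that(3)]] by simp
    show "(\<Sum>i\<in>set q. \<theta> i) = path_recourse I q" if "q \<in> \<pi>" for q
      using that T eq[OF that] by simp
  qed
qed

text \<open>Deleting the customers outside \<open>S\<close> cuts the paths into runs, which are the components of
  a forest on \<open>S\<close>.\<close>

lemma restrict_partition:
  assumes I: "vrpsd_instance I" and \<pi>: "\<pi> \<in> path_partitions I (customers I) k"
    and S: "S \<subseteq> customers I"
  obtains R where "R \<in> path_partitions I S (card R)"
    "\<And>r. r \<in> R \<Longrightarrow> r \<noteq> [] \<and> (\<exists>q\<in>\<pi>. sublist r q)"
    "card R + (\<Sum>e\<in>edges S. edge_vector \<pi> e) = card S"
proof -
  note D = path_partitionsD[OF \<pi>]
  have finS: "finite S" using S by (rule finite_subset) (simp add: customers_def)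
  have "\<forall>q\<in>\<pi>. \<exists>rs. concat rs = filter (\<lambda>i. i \<in> S) q \<and> [] \<notin> set rs \<and> (\<forall>r\<in>set rs. sublist r q)
    \<and> length rs + card (path_edges q \<inter> edges S) = card (S \<inter> set q)"
    using runs_exist D(4) by meson
  then obtain rs where rs: "\<And>q. q \<in> \<pi> \<Longrightarrow> concat (rs q) = filter (\<lambda>i. i \<in> S) q"
      "\<And>q. q \<in> \<pi> \<Longrightarrow> [] \<notin> set (rs q)"
      "\<And>q r. q \<in> \<pi> \<Longrightarrow> r \<in> set (rs q) \<Longrightarrow> sublist r q"
      "\<And>q. q \<in> \<pi> \<Longrightarrow> length (rs q) + card (path_edges q \<inter> edges S) = card (S \<inter> set q)"
    by metis
  define R where "R = (\<Union>q\<in>\<pi>. set (rs q))"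
  have dc: "distinct (concat (rs q))" if "q \<in> \<pi>" for q using rs(1) D(4) that by simp
  \<comment> \<open>A distinct concatenation could still repeat the empty list; there are no empty
    runs.\<close>
  have drs: "distinct (rs q)" if "q \<in> \<pi>" for q
    using dc[OF that] rs(2)[OF that] by (simp add: distinct_concat_iff removeAll_id)
  have disjR: "r = r'" if r: "r \<in> R" "r' \<in> R" "i \<in> set r" "i \<in> set r'" for r r' i
  proof -
    obtain q q' where q: "q \<in> \<pi>" "r \<in> set (rs q)" "q' \<in> \<pi>" "r' \<in> set (rs q')"
      using r by (auto simp: R_def)
    have "i \<in> set q" "i \<in> set q'" using q r rs(3) set_mono_sublist by blast+
    then have "q = q'" using path_partitions_disjoint[OF \<pi>] q by blast
    then show ?thesis using dc[OF q(1)] q r unfolding distinct_concat_iff by blast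
  qed
  have ne: "r \<noteq> []" if "r \<in> R" for r using that rs(2) by (auto simp: R_def)
  have sub: "\<exists>q\<in>\<pi>. sublist r q" if "r \<in> R" for r using that rs(3) by (auto simp: R_def)
  have un: "\<Union> (set ` R) = S"
  proof -
    have "\<Union> (set ` R) = (\<Union>q\<in>\<pi>. set (concat (rs q)))" by (auto simp: R_def)
    also have "\<dots> = (\<Union>q\<in>\<pi>. set q \<inter> S)" using rs(1) by auto
    finally show ?thesis using D(3) S by auto
  qed
  have "R \<subseteq> feasible_paths I" using sub ne sublist_feasible[OF I] D(2) by blast
  moreover have "finite R" using D(1) by (auto simp: R_def)
  moreover have "inj_on set R"
  proof (rule inj_onI)
    fix r r' assume r: "r \<in> R" "r' \<in> R" "set r = set r'"
    then show "r = r'" using disjR[OF r(1,2), of "hd r"] hd_in_set[OF ne[OF r(1)]] by simp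
  qed
  moreover have "partition_on S (set ` R)"
    unfolding partition_on_def disjoint_def using un ne disjR by auto
  ultimately have PR: "R \<in> path_partitions I S (card R)" by (simp add: path_partitions_def)
  have "card R = (\<Sum>q\<in>\<pi>. card (set (rs q)))"
    unfolding R_def
  proof (rule card_UN_disjoint)
    show "\<forall>q\<in>\<pi>. \<forall>q'\<in>\<pi>. q \<noteq> q' \<longrightarrow> set (rs q) \<inter> set (rs q') = {}"
    proof (intro ballI impI, rule ccontr)
      fix q q' assume q: "q \<in> \<pi>" "q' \<in> \<pi>" "q \<noteq> q'" "set (rs q) \<inter> set (rs q') \<noteq> {}"
      then obtain r where r: "r \<in> set (rs q)" "r \<in> set (rs q')" by auto
      then have "hd r \<in> set r" using rs(2) q by (metis hd_in_set)
      then have "hd r \<in> set q" "hd r \<in> set q'" using r q rs(3) set_mono_sublist by blast+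
      then show False using path_partitions_disjoint[OF \<pi>] q by blast
    qed
  qed (use D(1) in auto)
  also have "\<dots> = (\<Sum>q\<in>\<pi>. length (rs q))" using drs by (simp add: distinct_card)
  finally have cR: "card R = (\<Sum>q\<in>\<pi>. length (rs q))" .
  have "(\<Sum>e\<in>edges S. edge_vector \<pi> e) = card (edges S \<inter> \<Union> (path_edges ` \<pi>))"
    by (rule sum_edge_vector[OF \<pi> finite_edges[OF finS]])
      (use S in \<open>auto simp: edges_def customers_def\<close>)
  also have "edges S \<inter> \<Union> (path_edges ` \<pi>) = (\<Union>q\<in>\<pi>. path_edges q \<inter> edges S)" by auto
  also have "card \<dots> = (\<Sum>q\<in>\<pi>. card (path_edges q \<inter> edges S))"
  proof (rule card_UN_disjoint)
    show "\<forall>q\<in>\<pi>. \<forall>q'\<in>\<pi>. q \<noteq> q' \<longrightarrow>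
        (path_edges q \<inter> edges S) \<inter> (path_edges q' \<inter> edges S) = {}"
    proof (intro ballI impI, rule ccontr)
      fix q q' assume q: "q \<in> \<pi>" "q' \<in> \<pi>" "q \<noteq> q'"
        "(path_edges q \<inter> edges S) \<inter> (path_edges q' \<inter> edges S) \<noteq> {}"
      then obtain e where "e \<in> path_edges q" "e \<in> path_edges q'" by auto
      then obtain i where "i \<in> set q" "i \<in> set q'" using path_edges_subset by blast
      then show False using path_partitions_disjoint[OF \<pi>] q by blast
    qed
  qed (use D(1) in auto)
  finally have cE: "(\<Sum>e\<in>edges S. edge_vector \<pi> e) = (\<Sum>q\<in>\<pi>. card (path_edges q \<inter> edges S))" .
  \<comment> \<open>S is the disjoint union of its parts in the paths, so the identities from
    \<open>runs_exist\<close> add up.\<close>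
  have "card S = card (\<Union>q\<in>\<pi>. S \<inter> set q)" using D(3) S by (intro arg_cong[of _ _ card]) auto
  also have "\<dots> = (\<Sum>q\<in>\<pi>. card (S \<inter> set q))"
    by (rule card_UN_disjoint) (use D(1) path_partitions_disjoint[OF \<pi>] in auto)
  also have "\<dots> = (\<Sum>q\<in>\<pi>. length (rs q) + card (path_edges q \<inter> edges S))"
    using rs(4) by simp
  also have "\<dots> = card R + (\<Sum>e\<in>edges S. edge_vector \<pi> e)"
    by (simp add: cR cE sum.distrib)
  finally show thesis using that[of R] PR ne sub by simp
qed

section \<open>The prices satisfy the P-cuts and the S-cuts, and what P-cuts enforce\<close>

lemma P_cuts_prices:
  assumes I: "vrpsd_instance I" and \<pi>: "\<pi> \<in> path_partitions I (customers I) k"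
    and pr: "\<And>q r. q \<in> \<pi> \<Longrightarrow> r \<noteq> [] \<Longrightarrow> sublist r q \<Longrightarrow> path_recourse I r \<le> (\<Sum>i\<in>set r. \<theta> i)"
    and nn: "\<And>i. i \<in> customers I \<Longrightarrow> 0 \<le> \<theta> i"
  shows "P_cuts I (edge_vector \<pi>) \<theta>"
  unfolding P_cuts_def
proof
  fix p assume p: "p \<in> feasible_paths I"
  note F = feasible_pathsD[OF p]
  show "path_recourse I p * (real (path_value p (edge_vector \<pi>)) - real (card (set p)) + 2)
    \<le> (\<Sum>i\<in>set p. \<theta> i)"
  proof (cases "path_edges p \<subseteq> \<Union> (path_edges ` \<pi>)")
    case True
    then obtain q where "q \<in> \<pi>" "sublist p q \<or> sublist (rev p) q"
      using edge_vector_sublist[OF \<pi> p] by blast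
    \<comment> \<open>A piece read backwards has the same customers and the same recourse.\<close>
    then have "path_recourse I p \<le> (\<Sum>i\<in>set p. \<theta> i)"
      using pr[of q p] pr[of q "rev p"] F(1) by (auto simp: path_recourse_rev)
    then show ?thesis unfolding path_value_own[OF \<pi> p True] by simp
  next
    case False
    then have "path_recourse I p * (real (path_value p (edge_vector \<pi>)) - real (card (set p)) + 2) \<le> 0"
      using path_value_other[OF \<pi> p] path_recourse_nonneg[OF I p] by (intro mult_nonneg_nonpos) auto
    also have "0 \<le> (\<Sum>i\<in>set p. \<theta> i)" using nn F(3) by (intro sum_nonneg) auto
    finally show ?thesis .
  qed
qed

lemma S_cuts_prices:
  assumes I: "vrpsd_instance I" and adm: "admissible_S_cut_data I \<S> m L"
    and \<pi>: "\<pi> \<in> path_partitions I (customers I) k"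
    and pr: "\<And>q r. q \<in> \<pi> \<Longrightarrow> r \<noteq> [] \<Longrightarrow> sublist r q \<Longrightarrow> path_recourse I r \<le> (\<Sum>i\<in>set r. \<theta> i)"
    and nn: "\<And>i. i \<in> customers I \<Longrightarrow> 0 \<le> \<theta> i"
  shows "S_cuts \<S> m L (edge_vector \<pi>) \<theta>"
  unfolding S_cuts_def
proof
  fix S assume "S \<in> \<S>"
  then have S: "S \<subseteq> customers I" "m S \<le> min_paths I S" "0 \<le> L S"
    "ereal (L S) \<le> recourse_bound I S (m S)"
    using adm by (auto simp: admissible_S_cut_data_def)
  obtain R where R: "R \<in> path_partitions I S (card R)"
    "\<And>r. r \<in> R \<Longrightarrow> r \<noteq> [] \<and> (\<exists>q\<in>\<pi>. sublist r q)"
    "card R + (\<Sum>e\<in>edges S. edge_vector \<pi> e) = card S"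
    using restrict_partition[OF I \<pi> S(1)] by blast
  \<comment> \<open>The pieces form a feasible partition of S, so their number is at least
    m(S).\<close>
  have "min_paths I S \<le> card R" unfolding min_paths_def using R(1) by (intro Least_le) auto
  then have mR: "m S \<le> card R" using S(2) by simp
  have coef: "real (\<Sum>e\<in>edges S. edge_vector \<pi> e) - real (card S) + real (m S) + 1
    = real (m S) - real (card R) + 1"
    unfolding R(3)[symmetric] by simp
  \<comment> \<open>Since m_S <= \<open>card R\<close> are integers, the factor is 1 on equality and
    at most 0 otherwise. In the first case the pieces compete in the minimum that bounds
    L_S.\<close>
  have "L S * (real (m S) - real (card R) + 1) \<le> (\<Sum>i\<in>S. \<theta> i)"
  proof (cases "card R = m S")
    case True
    then have "R \<in> path_partitions I S (m S)" using R(1) by simp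
    then have "L S \<le> Min ((\<lambda>\<pi>. \<Sum>p\<in>\<pi>. path_recourse I p) ` path_partitions I S (m S))"
      using S(4) by (auto simp: recourse_bound_def split: if_splits)
    also have "\<dots> \<le> (\<Sum>p\<in>R. path_recourse I p)"
      using \<open>R \<in> path_partitions I S (m S)\<close> finite_path_partitions by (intro Min_le) auto
    also have "\<dots> \<le> (\<Sum>p\<in>R. \<Sum>i\<in>set p. \<theta> i)"
      using R(2) pr by (intro sum_mono) blast
    also have "\<dots> = (\<Sum>i\<in>S. \<theta> i)" using sum_path_partition[OF R(1)] by metis
    finally show ?thesis using True by simp
  next
    case False
    then have "L S * (real (m S) - real (card R) + 1) \<le> 0"
      using mR S(3) by (intro mult_nonneg_nonpos) auto
    also have "0 \<le> (\<Sum>i\<in>S. \<theta> i)" using nn S(1) by (intro sum_nonneg) auto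
    finally show ?thesis .
  qed
  then show "L S * (real (\<Sum>e\<in>edges S. edge_vector \<pi> e) - real (card S) + real (m S) + 1)
    \<le> (\<Sum>i\<in>S. \<theta> i)" unfolding coef .
qed

text \<open>Serves both directions: for the paths of x it gives the lower bound Q(x), for the two
  halves of a path it gives superadditivity.\<close>

lemma recourse_le_of_P_cuts:
  assumes \<pi>: "\<pi> \<in> path_partitions I (customers I) k" and P: "P_cuts I (edge_vector \<pi>) \<theta>"
    and p: "p \<in> feasible_paths I" "path_edges p \<subseteq> \<Union> (path_edges ` \<pi>)"
  shows "path_recourse I p \<le> (\<Sum>i\<in>set p. \<theta> i)"
proof -
  have "path_recourse I p * (real (path_value p (edge_vector \<pi>)) - real (card (set p)) + 2)
      \<le> (\<Sum>i\<in>set p. \<theta> i)"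
    using P p(1) unfolding P_cuts_def by blast
  then show ?thesis unfolding path_value_own[OF \<pi> p] by simp
qed

lemma valid_if_superadditive:
  assumes I: "vrpsd_instance I" and adm: "admissible_S_cut_data I \<S> m L"
    and sup: "superadditive_recourse I"
  shows "valid_reformulation I M \<S> m L"
  unfolding valid_reformulation_def
proof
  fix x assume x: "x \<in> first_stage_solutions I M"
  then obtain \<pi> k where \<pi>: "\<pi> \<in> path_partitions I (customers I) k" and x\<pi>: "x = edge_vector \<pi>"
    by (auto simp: first_stage_solutions_def)
  note D = path_partitionsD[OF \<pi>]
  obtain \<theta> where \<theta>:
    "\<And>q r. q \<in> \<pi> \<Longrightarrow> r \<noteq> [] \<Longrightarrow> sublist r q \<Longrightarrow> path_recourse I r \<le> (\<Sum>i\<in>set r. \<theta> i)"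
    "\<And>q. q \<in> \<pi> \<Longrightarrow> (\<Sum>i\<in>set q. \<theta> i) = path_recourse I q"
    using partition_prices[OF I sup \<pi>] by blast
  \<comment> \<open>The price inequality for the one-customer piece \<open>[i]\<close> bounds the
    price below by a nonnegative recourse.\<close>
  have nn: "0 \<le> \<theta> i" if i: "i \<in> customers I" for i
  proof -
    obtain q where q: "q \<in> \<pi>" "i \<in> set q" using D(3) i by blast
    then have "sublist [i] q" by (metis sublist_def split_list append_Cons append_Nil)
    then have "path_recourse I [i] \<le> \<theta> i" using \<theta>(1)[OF q(1), of "[i]"] by simp
    then show ?thesis using path_recourse_nonneg[OF I singleton_feasible[OF I i]] by simp
  qed
  have feas: "MP_feasible I M \<S> m L x \<theta>"
    unfolding MP_feasible_def x\<pi>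
  proof (intro conjI ballI nn)
    show "P_cuts I (edge_vector \<pi>) \<theta>" by (rule P_cuts_prices[OF I \<pi>]) (use \<theta>(1) nn in auto)
    show "S_cuts \<S> m L (edge_vector \<pi>) \<theta>"
      by (rule S_cuts_prices[OF I adm \<pi>]) (use \<theta>(1) nn in auto)
  qed (use x x\<pi> in auto)
  have val: "(\<Sum>i\<in>customers I. \<theta> i) = solution_recourse I x"
    unfolding x\<pi> solution_recourse_edge_vector[OF \<pi>] sum_path_partition[OF \<pi>] using \<theta>(2) by simp
  have low: "solution_recourse I x \<le> (\<Sum>i\<in>customers I. \<eta> i)" if "MP_feasible I M \<S> m L x \<eta>" for \<eta>
  proof -
    have "P_cuts I (edge_vector \<pi>) \<eta>" using that x\<pi> by (simp add: MP_feasible_def)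
    then show ?thesis
      unfolding x\<pi> solution_recourse_edge_vector[OF \<pi>] sum_path_partition[OF \<pi>]
      by (intro sum_mono recourse_le_of_P_cuts[OF \<pi>]) (use D(2) in auto)
  qed
  show "\<exists>\<theta>. is_arg_min (\<lambda>\<theta>. \<Sum>i\<in>customers I. \<theta> i) (MP_feasible I M \<S> m L x) \<theta> \<and>
      (\<Sum>i\<in>customers I. \<theta> i) = solution_recourse I x"
    unfolding is_arg_min_def
  proof (intro exI[of _ \<theta>] conjI feas val notI)
    assume "\<exists>\<eta>. MP_feasible I M \<S> m L x \<eta> \<and> (\<Sum>i\<in>customers I. \<eta> i) < (\<Sum>i\<in>customers I. \<theta> i)"
    then show False using low val by force
  qed
qed


section \<open>Validity implies superadditivity\<close>

lemma path_edges_append: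
  "path_edges p \<union> path_edges q \<subseteq> path_edges (p @ q)"
proof
  fix e assume "e \<in> path_edges p \<union> path_edges q"
  then consider us a b vs where "p = us @ a # b # vs" "e = {a, b}"
    | us a b vs where "q = us @ a # b # vs" "e = {a, b}"
    by (auto simp: path_edges_split)
  then show "e \<in> path_edges (p @ q)"
  proof cases
    case (1 us a b vs)
    then have "p @ q = us @ a # b # (vs @ q)" by simp
    then show ?thesis using 1 unfolding path_edges_split by blast
  next
    case (2 us a b vs)
    then have "p @ q = (p @ us) @ a # b # vs" by simp
    then show ?thesis using 2 unfolding path_edges_split by blast
  qed
qed

text \<open>Every feasible path occurs in some solution, because each customer alone fits the bound
  fQ.\<close>

lemma path_with_singletons:
  assumes I: "vrpsd_instance I" and p: "p \<in> feasible_paths I"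
  shows "insert p ((\<lambda>i. [i]) ` (customers I - set p)) \<in>
    path_partitions I (customers I) (Suc (card (customers I - set p)))"
proof -
  note F = feasible_pathsD[OF p]
  have fin: "finite (customers I)" by (simp add: customers_def)
  have "p \<notin> (\<lambda>i. [i]) ` (customers I - set p)" by auto
  then have "card (insert p ((\<lambda>i. [i]) ` (customers I - set p))) = Suc (card (customers I - set p))"
    using fin by (simp add: card_image inj_on_def)
  moreover have "insert p ((\<lambda>i. [i]) ` (customers I - set p)) \<subseteq> feasible_paths I"
    using p singleton_feasible[OF I] by auto
  moreover have "inj_on set (insert p ((\<lambda>i. [i]) ` (customers I - set p)))"
    by (auto simp: inj_on_def)
  moreover have "partition_on (customers I) (set ` insert p ((\<lambda>i. [i]) ` (customers I - set p)))"
    using F by (auto simp: partition_on_def disjoint_def)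
  ultimately show ?thesis using fin by (simp add: path_partitions_def)
qed

text \<open>Argued directly: validity supplies a feasible \<theta> with total Q(x), the P-cuts of
  the two halves and of the singletons bound this total from below, and the singleton terms
  cancel.\<close>

lemma superadditive_if_valid:
  assumes I: "vrpsd_instance I"
    and valid: "\<And>M. M \<subseteq> {1..num_customers I} \<Longrightarrow> valid_reformulation I M \<S> m L"
  shows "superadditive_recourse I"
  unfolding superadditive_recourse_def
proof (intro ballI impI)
  fix p1 p2 assume p: "p1 \<in> feasible_paths I" "p2 \<in> feasible_paths I" "p1 @ p2 \<in> feasible_paths I"
  define C where "C = customers I - set (p1 @ p2)"
  define \<pi> where "\<pi> = insert (p1 @ p2) ((\<lambda>i. [i]) ` C)"
  define k where "k = Suc (card C)"
  have \<pi>: "\<pi> \<in> path_partitions I (customers I) k"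
    using path_with_singletons[OF I p(3)] by (simp add: \<pi>_def k_def C_def)
  note F = feasible_pathsD[OF p(3)]
  have fin: "finite (customers I)" by (simp add: customers_def)
  \<comment> \<open>As \<open>p1\<close> is nonempty, C misses a customer; hence k <= n and {k} is a
    permitted set of route counts.\<close>
  have "C \<subset> customers I" using F(1,3) feasible_pathsD(1)[OF p(1)] by (cases p1) (auto simp: C_def)
  then have "card C < num_customers I" using psubset_card_mono[OF fin] by (simp add: customers_def)
  then have "valid_reformulation I {k} \<S> m L" by (intro valid) (simp add: k_def)
  moreover have "edge_vector \<pi> \<in> first_stage_solutions I {k}"
    using \<pi> by (auto simp: first_stage_solutions_def)
  ultimately obtain \<theta> where \<theta>: "MP_feasible I {k} \<S> m L (edge_vector \<pi>) \<theta>"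
    "(\<Sum>i\<in>customers I. \<theta> i) = solution_recourse I (edge_vector \<pi>)"
    unfolding valid_reformulation_def is_arg_min_def by blast
  have P: "P_cuts I (edge_vector \<pi>) \<theta>" using \<theta>(1) by (simp add: MP_feasible_def)
  have E: "path_edges p1 \<subseteq> \<Union> (path_edges ` \<pi>)" "path_edges p2 \<subseteq> \<Union> (path_edges ` \<pi>)"
    using path_edges_append[of p1 p2] by (auto simp: \<pi>_def)
  \<comment> \<open>Ensures that the sum over \<pi> counts the long path separately from the
    singletons.\<close>
  have notin: "p1 @ p2 \<notin> (\<lambda>i. [i]) ` C"
  proof
    assume "p1 @ p2 \<in> (\<lambda>i. [i]) ` C"
    then obtain i where i: "p1 @ p2 = [i]" "i \<in> C" by blast
    then have "i \<in> set (p1 @ p2)" by (simp del: set_append)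
    then show False using i(2) unfolding C_def by blast
  qed
  have inj: "inj_on (\<lambda>i. [i]) C" by (simp add: inj_on_def)
  have finC: "finite C" using fin by (simp add: C_def)
  \<comment> \<open>All edges of \<open>p1\<close>, of \<open>p2\<close> and (vacuously) of each
    singleton are used by the solution, so each of these P-cuts has factor 1.\<close>
  have "path_recourse I p1 + path_recourse I p2 + (\<Sum>i\<in>C. path_recourse I [i])
      \<le> (\<Sum>i\<in>set p1. \<theta> i) + (\<Sum>i\<in>set p2. \<theta> i) + (\<Sum>i\<in>C. \<theta> i)"
  proof (intro add_mono sum_mono)
    fix i assume "i \<in> C"
    then show "path_recourse I [i] \<le> \<theta> i"
      using recourse_le_of_P_cuts[OF \<pi> P, of "[i]"] singleton_feasible[OF I] by (simp add: C_def)
  qed (use recourse_le_of_P_cuts[OF \<pi> P] p E in auto)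
  also have "\<dots> = (\<Sum>i\<in>set (p1 @ p2). \<theta> i) + (\<Sum>i\<in>C. \<theta> i)"
    using F(2) by (simp add: sum.union_disjoint)
  also have "\<dots> = (\<Sum>i\<in>customers I. \<theta> i)"
    using sum.subset_diff[OF F(3) fin, of \<theta>] by (simp add: C_def)
  also have "\<dots> = (\<Sum>q\<in>\<pi>. path_recourse I q)"
    using \<theta>(2) solution_recourse_edge_vector[OF \<pi>] by simp
  also have "\<dots> = path_recourse I (p1 @ p2) + (\<Sum>i\<in>C. path_recourse I [i])"
    using notin finC by (simp add: \<pi>_def sum.reindex[OF inj])
  finally show "path_recourse I p1 + path_recourse I p2 \<le> path_recourse I (p1 @ p2)" by simp
qed

theorem theorem1:
  fixes I :: "'w vrpsd"
    and \<S> :: "nat set set" and m :: "nat set \<Rightarrow> nat" and L :: "nat set \<Rightarrow> real"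
  assumes "vrpsd_instance I"
    and "admissible_S_cut_data I \<S> m L"
  shows "(\<forall>M. M \<subseteq> {1..num_customers I} \<longrightarrow> valid_reformulation I M \<S> m L)
         \<longleftrightarrow> superadditive_recourse I"
  using valid_if_superadditive[OF assms] superadditive_if_valid[OF assms(1)] by blast

end
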